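(* Let $\mathcal A$ be a $k$-algebra and let $\Delta:\mathcal A\to\mathcal A\otimes\mathcal A$ be a comultiplication which is a morphism of algebras. Then: (i) If $k$ is a field, the Sweedler dual $\mathcal A^\circ$ of $\mathcal A$ is closed under the dual law ${}^t\Delta$, i.e. $f,g\in\mathcal A^\circ$ implies ${}^t\Delta(f,g)\in\mathcal A^\circ$. (ii) If $k$ is a semiring and $\mathcal A=k\langle X\rangle$ for a set $X$, then $\mathcal A^\circ$ is closed under the dual law ${}^t\Delta$.
   Context: A semiring $(k,+,\times)$ is a set with two laws such that $(k,+)$ is a commutative monoid with neutral $0_k$, $(k,\times)$ is a monoid (not required to be commutative) with neutral $1_k$, $\times$ distributes over $+$ on both sides, and $0_k$ is annihilating. Modules and algebras over a semiring are defined following the pattern for rings, the underlying additive structure being only a commutative monoid. Algebras are associative with unit. A comultiplication on $\mathcal A$ is a $k$-linear map $\Delta:\mathcal A\to\mathcal A\otimes\mathcal A$ (not assumed coassociative or counital), where $\mathcal A\otimes\mathcal A$ carries the product $(a\otimes b)(c\otimes d)=ac\otimes bd$. $\mathcal A^*$ denotes the set of $k$-linear forms on $\mathcal A$. The dual law ${}^t\Delta$ on $\mathcal A^*$ is given by ${}^t\Delta(f,g)(x)=(f\otimes g)(\Delta(x))$, where $(f\otimes g)(a\otimes b)=f(a)g(b)$. For a semiring $k$ and a set $X$, $X^*$ is the free monoid on $X$ and $k\langle X\rangle$ is the algebra of noncommutative polynomials, i.e. finitely supported functions $X^*\to k$ with convolution product. Linear forms on $k\langle X\rangle$ are identified with functions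 $X^*\to k$. The elements of $k\langle X\rangle\otimes k\langle X\rangle$ are the finite sums $\sum_{u,v\in X^*}c_{u,v}\,u\otimes v$ with $c_{u,v}\in k$, and if $\Delta(w)=\sum_{u,v}c_{u,v}\,u\otimes v$ for a word $w$, then ${}^t\Delta(f,g)(w)=\sum_{u,v}c_{u,v}f(u)g(v)$. Sweedler's dual $\mathcal A^\circ$: - If $k$ is a field, $\mathcal A^\circ$ is the set of $f\in\mathcal A^*$ for which there exist an integer $n$, $\lambda\in k^{1\times n}$, $\gamma\in k^{n\times1}$ and a morphism of unital $k$-algebras $\mu:\mathcal A\to k^{n\times n}$ with $f(x)=\lambda\mu(x)\gamma$ for all $x\in\mathcal A$ (equivalently, $(x,y)\mapsto f(xy)$ is of the form $\sum_{i=1}^n g_i(x)h_i(y)$ with $g_i,h_i\in\mathcal A^*$). - If $k$ is a semiring and $\mathcal A=k\langle X\rangle$, $\mathcal A^\circ$ is the set of $f:X^*\to k$ for which there exist an integer $n$, $\lambda\in k^{1\times n}$, $\gamma\in k^{n\times1}$ and a morphism of monoids $\mu:X^*\to(k^{n\times n},\times)$ with $f(w)=\lambda\mu(w)\gamma$ for all $w\in X^*$.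
   Formalization: In (ii) k⟨X⟩ is required to be a k-algebra with bilinear product, which forces the semiring k to be commutative; for non-commutative k the law (a⊗b)(c⊗d)=ac⊗bd is inconsistent, and closure fails, e.g. for k=ℕ⟨a,b⟩ and Δ(xⁿ)=xⁿ⊗xⁿ. *)

theory Defs
  imports "HOL-Algebra.Module" "Jordan_Normal_Form.Matrix"
begin

text \<open>
  The scalars form a type of sort \<open>{semiring_0, monoid_mult}\<close>: this is a semiring in the sense
  of a commutative additive monoid and a (not necessarily commutative) multiplicative monoid with
  distributivity and annihilating zero.  Unlike \<open>semiring_1\<close>, the sort allows \<open>0 = 1\<close>.
  Algebras are records with explicit carriers.
\<close>

locale k_algebra = Ring.semiring A
  for A :: "('k::{semiring_0, monoid_mult}, 'a) module" (structure) +
  assumes smult_closed: "x \<in> carrier A \<Longrightarrow> r \<odot> x \<in> carrier A"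
    and smult_l_distr: "x \<in> carrier A \<Longrightarrow> (r + s) \<odot> x = r \<odot> x \<oplus> s \<odot> x"
    and smult_r_distr:
      "\<lbrakk>x \<in> carrier A; y \<in> carrier A\<rbrakk> \<Longrightarrow> r \<odot> (x \<oplus> y) = r \<odot> x \<oplus> r \<odot> y"
    and smult_smult: "x \<in> carrier A \<Longrightarrow> (r * s) \<odot> x = r \<odot> (s \<odot> x)"
    and smult_one: "x \<in> carrier A \<Longrightarrow> 1 \<odot> x = x"
    and smult_zero_left: "x \<in> carrier A \<Longrightarrow> 0 \<odot> x = \<zero>"
    and smult_zero_right: "r \<odot> \<zero> = \<zero>"
    and smult_mult_left:
      "\<lbrakk>x \<in> carrier A; y \<in> carrier A\<rbrakk> \<Longrightarrow> (r \<odot> x) \<otimes> y = r \<odot> (x \<otimes> y)"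
    and smult_mult_right:
      "\<lbrakk>x \<in> carrier A; y \<in> carrier A\<rbrakk> \<Longrightarrow> x \<otimes> (r \<odot> y) = r \<odot> (x \<otimes> y)"

definition linear_maps ::
  "('k, 'a, 'm) module_scheme \<Rightarrow> ('k, 'b, 'n) module_scheme \<Rightarrow> ('a \<Rightarrow> 'b) set" where
  "linear_maps A B = {h. h \<in> carrier A \<rightarrow> carrier B \<and>
     (\<forall>x\<in>carrier A. \<forall>y\<in>carrier A. h (x \<oplus>\<^bsub>A\<^esub> y) = h x \<oplus>\<^bsub>B\<^esub> h y) \<and>
     (\<forall>r. \<forall>x\<in>carrier A. h (r \<odot>\<^bsub>A\<^esub> x) = r \<odot>\<^bsub>B\<^esub> h x)}"

text \<open>\<open>ring_hom\<close> includes preservation of the unit.\<close>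

definition algebra_homs ::
  "('k, 'a, 'm) module_scheme \<Rightarrow> ('k, 'b, 'n) module_scheme \<Rightarrow> ('a \<Rightarrow> 'b) set" where
  "algebra_homs A B = linear_maps A B \<inter> ring_hom A B"

definition linear_forms ::
  "('k::{semiring_0, monoid_mult}, 'a, 'm) module_scheme \<Rightarrow> ('a \<Rightarrow> 'k) set" where
  "linear_forms A = {f.
     (\<forall>x\<in>carrier A. \<forall>y\<in>carrier A. f (x \<oplus>\<^bsub>A\<^esub> y) = f x + f y) \<and>
     (\<forall>r. \<forall>x\<in>carrier A. f (r \<odot>\<^bsub>A\<^esub> x) = r * f x)}"


subsection \<open>Finitely supported functions\<close>

definition supp :: "('s \<Rightarrow> 'k::zero) \<Rightarrow> 's set" where
  "supp c = {s. c s \<noteq> 0}"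

definition fin_funs :: "'s set \<Rightarrow> ('s \<Rightarrow> 'k::zero) set" where
  "fin_funs S = {c. finite (supp c) \<and> supp c \<subseteq> S}"

definition single :: "'s \<Rightarrow> 's \<Rightarrow> 'k::{semiring_0, monoid_mult}" where
  "single s = (\<lambda>t. if t = s then 1 else 0)"

definition fplus :: "('s \<Rightarrow> 'k::semiring_0) \<Rightarrow> ('s \<Rightarrow> 'k) \<Rightarrow> 's \<Rightarrow> 'k" where
  "fplus c d = (\<lambda>s. c s + d s)"

definition fscale :: "'k::semiring_0 \<Rightarrow> ('s \<Rightarrow> 'k) \<Rightarrow> 's \<Rightarrow> 'k" where
  "fscale r c = (\<lambda>s. r * c s)"

text \<open>Bilinear extension of an operation \<open>m\<close> on the index set.\<close>

definition convolution ::
  "('s \<Rightarrow> 's \<Rightarrow> 's) \<Rightarrow> ('s \<Rightarrow> 'k::semiring_0) \<Rightarrow> ('s \<Rightarrow> 'k) \<Rightarrow> 's \<Rightarrow> 'k" where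
  "convolution m c d =
     (\<lambda>p. \<Sum>s\<in>supp c. \<Sum>t\<in>supp d. if m s t = p then c s * d t else 0)"

text \<open>Linear extension of a function on the index set.\<close>

definition lin_ext :: "('s \<Rightarrow> 'k::semiring_0) \<Rightarrow> ('s \<Rightarrow> 'k) \<Rightarrow> 'k" where
  "lin_ext f c = (\<Sum>s\<in>supp c. c s * f s)"


subsection \<open>The tensor square of an algebra\<close>

text \<open>
  The tensor square is the free module on \<open>carrier A \<times> carrier A\<close> modulo the least congruence
  making \<open>(a, b) \<mapsto> a \<otimes> b\<close> bilinear.  Over a semiring a quotient by a submodule is not
  available, so the congruence itself is generated.  Compatibility with zero is the case
  \<open>r = 0\<close> of the scalar rules.
\<close>

inductive tensor_cong ::
  "('k::{semiring_0, monoid_mult}, 'a) module \<Rightarrow> ('a \<times> 'a \<Rightarrow> 'k) \<Rightarrow> ('a \<times> 'a \<Rightarrow> 'k) \<Rightarrow> bool"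
  for A (structure) where
  refl: "c \<in> fin_funs (carrier A \<times> carrier A) \<Longrightarrow> tensor_cong A c c"
| sym: "tensor_cong A c d \<Longrightarrow> tensor_cong A d c"
| trans: "tensor_cong A c d \<Longrightarrow> tensor_cong A d e \<Longrightarrow> tensor_cong A c e"
| plus: "tensor_cong A c d \<Longrightarrow> tensor_cong A c' d' \<Longrightarrow> tensor_cong A (fplus c c') (fplus d d')"
| scale: "tensor_cong A c d \<Longrightarrow> tensor_cong A (fscale r c) (fscale r d)"
| add_left: "\<lbrakk>a \<in> carrier A; a' \<in> carrier A; b \<in> carrier A\<rbrakk> \<Longrightarrow>
    tensor_cong A (single (a \<oplus> a', b)) (fplus (single (a, b)) (single (a', b)))"
| add_right: "\<lbrakk>a \<in> carrier A; b \<in> carrier A; b' \<in> carrier A\<rbrakk> \<Longrightarrow>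
    tensor_cong A (single (a, b \<oplus> b')) (fplus (single (a, b)) (single (a, b')))"
| smult_left: "\<lbrakk>a \<in> carrier A; b \<in> carrier A\<rbrakk> \<Longrightarrow>
    tensor_cong A (single (r \<odot> a, b)) (fscale r (single (a, b)))"
| smult_right: "\<lbrakk>a \<in> carrier A; b \<in> carrier A\<rbrakk> \<Longrightarrow>
    tensor_cong A (single (a, r \<odot> b)) (fscale r (single (a, b)))"

definition tensor_class ::
  "('k::{semiring_0, monoid_mult}, 'a) module \<Rightarrow> ('a \<times> 'a \<Rightarrow> 'k) \<Rightarrow> ('a \<times> 'a \<Rightarrow> 'k) set" where
  "tensor_class A c = {d. tensor_cong A c d}"

definition pair_mult ::
  "('k::{semiring_0, monoid_mult}, 'a) module \<Rightarrow> 'a \<times> 'a \<Rightarrow> 'a \<times> 'a \<Rightarrow> 'a \<times> 'a" where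
  "pair_mult A p q = (fst p \<otimes>\<^bsub>A\<^esub> fst q, snd p \<otimes>\<^bsub>A\<^esub> snd q)"

definition tensor_square ::
  "('k::{semiring_0, monoid_mult}, 'a) module \<Rightarrow> ('k, ('a \<times> 'a \<Rightarrow> 'k) set) module" where
  "tensor_square A = \<lparr>
     carrier = tensor_class A ` fin_funs (carrier A \<times> carrier A),
     mult = (\<lambda>S T. \<Union>c\<in>S. \<Union>d\<in>T. tensor_class A (convolution (pair_mult A) c d)),
     one = tensor_class A (single (\<one>\<^bsub>A\<^esub>, \<one>\<^bsub>A\<^esub>)),
     zero = tensor_class A (\<lambda>_. 0),
     add = (\<lambda>S T. \<Union>c\<in>S. \<Union>d\<in>T. tensor_class A (fplus c d)),
     smult = (\<lambda>r S. \<Union>c\<in>S. tensor_class A (fscale r c))\<rparr>"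

definition pure_tensor ::
  "('k::{semiring_0, monoid_mult}, 'a) module \<Rightarrow> 'a \<Rightarrow> 'a \<Rightarrow> ('a \<times> 'a \<Rightarrow> 'k) set" where
  "pure_tensor A a b = tensor_class A (single (a, b))"

text \<open>
  \<open>f \<otimes> g\<close> on a class is the common value on its representatives of the linear extension of
  \<open>(a, b) \<mapsto> f a * g b\<close>.
\<close>

definition tensor_form ::
  "('a \<Rightarrow> 'k::semiring_0) \<Rightarrow> ('a \<Rightarrow> 'k) \<Rightarrow> ('a \<times> 'a \<Rightarrow> 'k) set \<Rightarrow> 'k" where
  "tensor_form f g T = the_elem (lin_ext (\<lambda>(a, b). f a * g b) ` T)"

definition comultiplications ::
  "('k::{semiring_0, monoid_mult}, 'a) module \<Rightarrow> ('a \<Rightarrow> ('a \<times> 'a \<Rightarrow> 'k) set) set" where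
  "comultiplications A = linear_maps A (tensor_square A)"

definition dual_law ::
  "('a \<Rightarrow> ('a \<times> 'a \<Rightarrow> 'k::semiring_0) set) \<Rightarrow> ('a \<Rightarrow> 'k) \<Rightarrow> ('a \<Rightarrow> 'k) \<Rightarrow> 'a \<Rightarrow> 'k" where
  "dual_law \<Delta> f g = (\<lambda>x. tensor_form f g (\<Delta> x))"


subsection \<open>Sweedler's dual over a field\<close>

text \<open>\<open>module_mat TYPE('k) n n\<close> is the algebra of \<open>n \<times> n\<close> matrices.\<close>

definition sweedler_dual :: "('k::field, 'a) module \<Rightarrow> ('a \<Rightarrow> 'k) set" where
  "sweedler_dual A = {f \<in> linear_forms A. \<exists>n lam \<mu> gam.
     lam \<in> carrier_mat 1 n \<and> gam \<in> carrier_mat n 1 \<and>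
     \<mu> \<in> algebra_homs A (module_mat TYPE('k) n n) \<and>
     (\<forall>x\<in>carrier A. f x = (lam * \<mu> x * gam) $$ (0, 0))}"


subsection \<open>Noncommutative polynomials\<close>

text \<open>Words over \<open>X\<close> are the elements of \<open>lists X\<close>; the word \<open>w\<close> is the polynomial \<open>single w\<close>.\<close>

definition nc_poly :: "'x set \<Rightarrow> ('k::{semiring_0, monoid_mult}, 'x list \<Rightarrow> 'k) module" where
  "nc_poly X = \<lparr>
     carrier = fin_funs (lists X),
     mult = convolution (@),
     one = single [],
     zero = (\<lambda>_. 0),
     add = fplus,
     smult = fscale\<rparr>"

definition sweedler_dual_words ::
  "'x set \<Rightarrow> ('x list \<Rightarrow> 'k::{semiring_0, monoid_mult}) set" where
  "sweedler_dual_words X = {f. \<exists>n lam \<mu> gam.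
     lam \<in> carrier_mat 1 n \<and> gam \<in> carrier_mat n 1 \<and>
     \<mu> \<in> lists X \<rightarrow> carrier_mat n n \<and> \<mu> [] = 1\<^sub>m n \<and>
     (\<forall>u\<in>lists X. \<forall>v\<in>lists X. \<mu> (u @ v) = \<mu> u * \<mu> v) \<and>
     (\<forall>w\<in>lists X. f w = (lam * \<mu> w * gam) $$ (0, 0))}"

text \<open>
  The dual law of \<open>nc_poly X\<close> under the identification of a linear form with its restriction to
  words, whose inverse is \<open>lin_ext\<close>.
\<close>

definition dual_law_words ::
  "(('x list \<Rightarrow> 'k) \<Rightarrow> (('x list \<Rightarrow> 'k) \<times> ('x list \<Rightarrow> 'k) \<Rightarrow> 'k::{semiring_0, monoid_mult}) set) \<Rightarrow>
   ('x list \<Rightarrow> 'k) \<Rightarrow> ('x list \<Rightarrow> 'k) \<Rightarrow> 'x list \<Rightarrow> 'k" where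
  "dual_law_words \<Delta> f g = (\<lambda>w. dual_law \<Delta> (lin_ext f) (lin_ext g) (single w))"


subsection \<open>Well-definedness\<close>

lemma lin_ext_superset:
  assumes "finite B" "supp c \<subseteq> B"
  shows "lin_ext f c = (\<Sum>s\<in>B. c s * f s)"
  unfolding lin_ext_def using assms
  by (intro sum.mono_neutral_left) (auto simp: supp_def)

lemma supp_fplus: "supp (fplus c d) \<subseteq> supp c \<union> supp d"
  by (auto simp: supp_def fplus_def)

lemma supp_fscale: "supp (fscale r c) \<subseteq> supp c"
  by (auto simp: supp_def fscale_def)

lemma supp_single: "supp (single s :: 's \<Rightarrow> 'k::{semiring_0, monoid_mult}) \<subseteq> {s}"
  by (auto simp: supp_def single_def)

lemma fin_funs_fplus: "c \<in> fin_funs S \<Longrightarrow> d \<in> fin_funs S \<Longrightarrow> fplus c d \<in> fin_funs S"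
  using supp_fplus[of c d] by (auto simp: fin_funs_def intro: finite_subset)

lemma fin_funs_fscale: "c \<in> fin_funs S \<Longrightarrow> fscale r c \<in> fin_funs S"
  using supp_fscale[of r c] by (auto simp: fin_funs_def intro: finite_subset)

lemma fin_funs_single: "s \<in> S \<Longrightarrow> single s \<in> fin_funs S"
  using supp_single[of s] by (auto simp: fin_funs_def intro: finite_subset)

lemma fin_funs_zero: "(\<lambda>_. 0) \<in> fin_funs S"
  by (auto simp: fin_funs_def supp_def)

lemma lin_ext_fplus:
  assumes "finite (supp c)" "finite (supp d)"
  shows "lin_ext f (fplus c d) = lin_ext f c + lin_ext f d"
proof -
  let ?B = "supp c \<union> supp d"
  have fin: "finite ?B" using assms by simp
  have "lin_ext f (fplus c d) = (\<Sum>s\<in>?B. c s * f s + d s * f s)"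
    unfolding lin_ext_superset[OF fin supp_fplus] by (simp add: fplus_def distrib_right)
  then show ?thesis
    by (simp add: sum.distrib lin_ext_superset[OF fin])
qed

lemma lin_ext_fscale:
  assumes "finite (supp c)"
  shows "lin_ext f (fscale r c) = r * lin_ext f c"
  unfolding lin_ext_superset[OF assms supp_fscale]
  by (simp add: lin_ext_def fscale_def mult.assoc sum_distrib_left)

lemma lin_ext_single: "lin_ext f (single s) = f s"
  by (subst lin_ext_superset[OF _ supp_single]) (simp_all add: single_def)

lemma convolution_superset:
  assumes "finite B" "supp c \<subseteq> B" "finite D" "supp d \<subseteq> D"
  shows "convolution m c d p = (\<Sum>s\<in>B. \<Sum>t\<in>D. if m s t = p then c s * d t else 0)"
proof -
  have "(\<Sum>s\<in>supp c. \<Sum>t\<in>supp d. if m s t = p then c s * d t else 0) =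
    (\<Sum>s\<in>supp c. \<Sum>t\<in>D. if m s t = p then c s * d t else 0)"
    using assms by (intro sum.cong refl sum.mono_neutral_left) (auto simp: supp_def)
  also have "\<dots> = (\<Sum>s\<in>B. \<Sum>t\<in>D. if m s t = p then c s * d t else 0)"
    using assms by (intro sum.mono_neutral_left ballI sum.neutral) (auto simp: supp_def)
  finally show ?thesis by (simp add: convolution_def)
qed

lemma convolution_fplus_left:
  assumes "finite (supp c)" "finite (supp c')" "finite (supp d)"
  shows "convolution m (fplus c c') d = fplus (convolution m c d) (convolution m c' d)"
proof
  fix p
  let ?B = "supp c \<union> supp c'"
  have fin: "finite ?B" using assms by simp
  note S = convolution_superset[OF fin _ assms(3) subset_refl]
  show "convolution m (fplus c c') d p = fplus (convolution m c d) (convolution m c' d) p"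
    unfolding fplus_def[of "convolution m c d"]
    by (subst S[OF supp_fplus] S[of c] S[of c']; (simp; fail)?)+
       (auto simp: sum.distrib[symmetric] fplus_def distrib_right intro!: sum.cong)
qed

lemma convolution_fplus_right:
  assumes "finite (supp c)" "finite (supp d)" "finite (supp d')"
  shows "convolution m c (fplus d d') = fplus (convolution m c d) (convolution m c d')"
proof
  fix p
  let ?B = "supp d \<union> supp d'"
  have fin: "finite ?B" using assms by simp
  note S = convolution_superset[OF assms(1) subset_refl fin]
  show "convolution m c (fplus d d') p = fplus (convolution m c d) (convolution m c d') p"
    unfolding fplus_def[of "convolution m c d"]
    by (subst S[OF supp_fplus] S[of d] S[of d']; (simp; fail)?)+
       (auto simp: sum.distrib[symmetric] fplus_def distrib_left intro!: sum.cong)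
qed

lemma convolution_fscale_left:
  assumes "finite (supp c)" "finite (supp d)"
  shows "convolution m (fscale r c) d = fscale r (convolution m c d)"
proof
  fix p
  show "convolution m (fscale r c) d p = fscale r (convolution m c d) p"
    unfolding fscale_def[of r "convolution m c d"]
    unfolding convolution_superset[OF assms(1) supp_fscale assms(2) subset_refl]
      convolution_superset[OF assms(1) subset_refl assms(2) subset_refl]
    by (auto simp: sum_distrib_left fscale_def mult.assoc intro!: sum.cong)
qed

lemma convolution_fscale_right:
  fixes c :: "'s \<Rightarrow> 'k::semiring_0"
  assumes "finite (supp c)" "finite (supp d)" and comm: "\<And>a b :: 'k. a * b = b * a"
  shows "convolution m c (fscale r d) = fscale r (convolution m c d)"
proof
  fix p
  have "a * (r * b) = r * (a * b)" for a b :: 'k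
    by (metis comm mult.assoc)
  then show "convolution m c (fscale r d) p = fscale r (convolution m c d) p"
    unfolding fscale_def[of r "convolution m c d"]
    unfolding convolution_superset[OF assms(1) subset_refl assms(2) supp_fscale]
      convolution_superset[OF assms(1) subset_refl assms(2) subset_refl]
    by (auto simp: sum_distrib_left fscale_def intro!: sum.cong)
qed

lemma convolution_single: "convolution m (single s) (single t) = single (m s t)"
  by (rule ext, subst convolution_superset[OF _ supp_single _ supp_single])
     (auto simp: single_def)

lemma convolution_closed:
  assumes "c \<in> fin_funs S" "d \<in> fin_funs S" "\<And>s t. s \<in> S \<Longrightarrow> t \<in> S \<Longrightarrow> m s t \<in> S"
  shows "convolution m c d \<in> fin_funs S"
proof -
  have "supp (convolution m c d) \<subseteq> (\<lambda>x. m (fst x) (snd x)) ` (supp c \<times> supp d)" (is "_ \<subseteq> ?I")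
  proof
    fix p assume "p \<in> supp (convolution m c d)"
    then have "(\<Sum>s\<in>supp c. \<Sum>t\<in>supp d. if m s t = p then c s * d t else 0) \<noteq> 0"
      unfolding supp_def[of "convolution m c d"] mem_Collect_eq by (simp add: convolution_def)
    then obtain s where s: "s \<in> supp c" "(\<Sum>t\<in>supp d. if m s t = p then c s * d t else 0) \<noteq> 0"
      by (rule sum.not_neutral_contains_not_neutral)
    from s(2) obtain t where t: "t \<in> supp d" "(if m s t = p then c s * d t else 0) \<noteq> 0"
      by (rule sum.not_neutral_contains_not_neutral)
    from t(2) have "p = m s t" by (simp split: if_splits)
    with s(1) t(1) show "p \<in> ?I" by (intro image_eqI[of _ _ "(s, t)"]) simp_all
  qed
  moreover have "finite ?I" using assms by (simp add: fin_funs_def)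
  moreover have "?I \<subseteq> S"
  proof
    fix p assume "p \<in> ?I"
    then obtain x where "x \<in> supp c \<times> supp d" "p = m (fst x) (snd x)" by (rule imageE)
    then show "p \<in> S" using assms by (auto simp: fin_funs_def mem_Times_iff)
  qed
  ultimately show ?thesis
    unfolding fin_funs_def mem_Collect_eq by (meson finite_subset subset_trans)
qed

lemma fin_funs_induct [consumes 1, case_names zero step]:
  fixes c :: "'s \<Rightarrow> 'k::{semiring_0, monoid_mult}"
  assumes "c \<in> fin_funs S" "P (\<lambda>_. 0)"
    and "\<And>r s c. s \<in> S \<Longrightarrow> c \<in> fin_funs S \<Longrightarrow> P c \<Longrightarrow> P (fplus (fscale r (single s)) c)"
  shows "P c"
proof -
  have "finite B \<Longrightarrow> B \<subseteq> S \<Longrightarrow> supp c \<subseteq> B \<Longrightarrow> P c" for B c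
  proof (induction B arbitrary: c rule: finite_induct)
    case empty
    then have "c = (\<lambda>_. 0)" by (auto simp: supp_def)
    then show ?case using assms(2) by simp
  next
    case (insert x B)
    let ?c = "c(x := 0)"
    have s: "supp ?c \<subseteq> B" using insert by (auto simp: supp_def split: if_splits)
    moreover have "c = fplus (fscale (c x) (single x)) ?c"
      by (auto simp: fplus_def fscale_def single_def)
    moreover have "?c \<in> fin_funs S"
      using s insert by (auto simp: fin_funs_def intro: finite_subset)
    ultimately show ?case using insert assms(3)[of x ?c "c x"] by auto
  qed
  then show ?thesis using assms(1) by (auto simp: fin_funs_def)
qed

lemma convolution_zero: "convolution m (\<lambda>_. 0) d = (\<lambda>_. 0)" "convolution m c (\<lambda>_. 0) = (\<lambda>_. 0)"
  by (auto simp: convolution_def supp_def)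

lemma fplus_zero: "fplus c (\<lambda>_. 0) = c" by (simp add: fplus_def)
lemma fin_supp: "c \<in> fin_funs S \<Longrightarrow> finite (supp c)" by (simp add: fin_funs_def)

context k_algebra
begin

lemma tensor_cong_fin_funs: "tensor_cong A c d \<Longrightarrow> c \<in> fin_funs (carrier A \<times> carrier A) \<and> d \<in> fin_funs (carrier A \<times> carrier A)"
  by (induction rule: tensor_cong.induct)
     (auto intro!: fin_funs_fplus fin_funs_fscale fin_funs_single smult_closed)

lemma tensor_class_eq_iff:
  assumes "d \<in> fin_funs (carrier A \<times> carrier A)"
  shows "tensor_class A c = tensor_class A d \<longleftrightarrow> tensor_cong A c d"
  using tensor_cong.refl[OF assms] unfolding tensor_class_def
  by (auto intro: tensor_cong.sym tensor_cong.trans)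

end

lemma tensor_cong_convolution:
  fixes A :: "('k::{semiring_0, monoid_mult}, 'a) module"
  assumes "k_algebra A" and comm: "\<And>a b :: 'k. a * b = b * a"
    and "tensor_cong A c c'" "d \<in> fin_funs (carrier A \<times> carrier A)"
  shows "tensor_cong A (convolution (pair_mult A) c d) (convolution (pair_mult A) c' d)"
    (is "tensor_cong A (?m c d) (?m c' d)")
    and "tensor_cong A (convolution (pair_mult A) d c) (convolution (pair_mult A) d c')"
proof -
  interpret k_algebra A by fact
  let ?S = "carrier A \<times> carrier A"
  have pm: "pair_mult A s t \<in> ?S" if "s \<in> ?S" "t \<in> ?S" for s t
    using that by (auto simp: pair_mult_def)
  note closed = convolution_closed[of _ ?S _ "pair_mult A", OF _ _ pm]
  note fin = fin_supp[OF fin_funs_single[of _ UNIV]] fin_supp[OF fin_funs_fscale[OF fin_funs_single[of _ UNIV]]]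
    fin_supp[OF fin_funs_fplus[OF fin_funs_single fin_funs_single, of _ UNIV]]
  note bil = convolution_fplus_left convolution_fplus_right convolution_fscale_left
    convolution_fscale_right[OF _ _ comm] fin convolution_single convolution_zero
  have gen: "tensor_cong A (?m x d) (?m y d) \<and> tensor_cong A (?m d x) (?m d y)"
    if xy: "x \<in> fin_funs ?S" "y \<in> fin_funs ?S"
      and st: "\<And>t. t \<in> ?S \<Longrightarrow> tensor_cong A (?m x (single t)) (?m y (single t))
           \<and> tensor_cong A (?m (single t) x) (?m (single t) y)"
    for x y
    using assms(4)
  proof (induction d rule: fin_funs_induct)
    case zero
    then show ?case by (simp add: convolution_zero tensor_cong.refl[OF fin_funs_zero])
  next
    case (step r s d)
    then show ?case using xy st[of s]
      by (simp add: bil fin_supp[of _ ?S] tensor_cong.plus tensor_cong.scale)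
  qed
  have "tensor_cong A (?m c d) (?m c' d) \<and> tensor_cong A (?m d c) (?m d c')"
    using assms(3)
  proof (induction rule: tensor_cong.induct)
    case (refl c)
    then show ?case using assms(4) by (auto intro!: tensor_cong.refl closed)
  next
    case (sym c d)
    then show ?case by (auto intro: tensor_cong.sym)
  next
    case (trans c d e)
    then show ?case by (auto intro: tensor_cong.trans)
  next
    case (plus c e c' e')
    then show ?case
      using tensor_cong_fin_funs[OF plus(1)] tensor_cong_fin_funs[OF plus(2)] assms(4)
      by (auto simp: bil fin_supp[of _ ?S] intro!: tensor_cong.plus)
  next
    case (scale c e r)
    then show ?case
      using tensor_cong_fin_funs[OF scale(1)] assms(4)
      by (auto simp: bil fin_supp[of _ ?S] intro!: tensor_cong.scale)
  next
    case (add_left a a' b)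
    show ?case
      by (rule gen) (use add_left in \<open>auto simp: bil pair_mult_def l_distr r_distr
        intro!: fin_funs_single fin_funs_fplus tensor_cong.add_left\<close>)
  next
    case (add_right a b b')
    show ?case
      by (rule gen) (use add_right in \<open>auto simp: bil pair_mult_def l_distr r_distr
        intro!: fin_funs_single fin_funs_fplus tensor_cong.add_right\<close>)
  next
    case (smult_left a b r)
    show ?case
      by (rule gen) (use smult_left in \<open>auto simp: bil pair_mult_def smult_mult_left smult_mult_right
        intro!: fin_funs_single fin_funs_fscale tensor_cong.smult_left smult_closed\<close>)
  next
    case (smult_right a b r)
    show ?case
      by (rule gen) (use smult_right in \<open>auto simp: bil pair_mult_def smult_mult_left smult_mult_right
        intro!: fin_funs_single fin_funs_fscale tensor_cong.smult_right smult_closed\<close>)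
  qed
  then show "tensor_cong A (?m c d) (?m c' d)" "tensor_cong A (?m d c) (?m d c')" by auto
qed

text \<open>
  The operations of the tensor square do not depend on representatives.
\<close>

lemma tensor_square_ops:
  fixes A :: "('k::{semiring_0, monoid_mult}, 'a) module"
  assumes "k_algebra A" and comm: "\<And>a b :: 'k. a * b = b * a"
    and c: "c \<in> fin_funs (carrier A \<times> carrier A)" and d: "d \<in> fin_funs (carrier A \<times> carrier A)"
  shows "tensor_class A c \<otimes>\<^bsub>tensor_square A\<^esub> tensor_class A d =
      tensor_class A (convolution (pair_mult A) c d)"
    and "tensor_class A c \<oplus>\<^bsub>tensor_square A\<^esub> tensor_class A d = tensor_class A (fplus c d)"
    and "r \<odot>\<^bsub>tensor_square A\<^esub> tensor_class A c = tensor_class A (fscale r c)"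
proof -
  interpret k_algebra A by fact
  have eq: "tensor_class A x = tensor_class A y" if "tensor_cong A y x" for x y
    using that unfolding tensor_class_def by (auto intro: tensor_cong.sym tensor_cong.trans)
  have mem: "x \<in> tensor_class A x" if "x \<in> fin_funs (carrier A \<times> carrier A)" for x
    using tensor_cong.refl[OF that] by (simp add: tensor_class_def)
  have UN: "(\<Union>x\<in>tensor_class A u. F x) = F u"
    if "u \<in> fin_funs (carrier A \<times> carrier A)" "\<And>x. tensor_cong A u x \<Longrightarrow> F x = F u"
    for u and F :: "_ \<Rightarrow> ('a \<times> 'a \<Rightarrow> 'k) set"
  proof -
    have "F x = F u" if "x \<in> tensor_class A u" for x
      using that by (intro \<open>\<And>x. tensor_cong A u x \<Longrightarrow> F x = F u\<close>) (simp add: tensor_class_def)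
    then show ?thesis using mem[OF that(1)] by blast
  qed
  have UN2: "(\<Union>x\<in>tensor_class A c. \<Union>y\<in>tensor_class A d. tensor_class A (G x y)) = tensor_class A (G c d)"
    if "\<And>x y. tensor_cong A c x \<Longrightarrow> tensor_cong A d y \<Longrightarrow> tensor_cong A (G c d) (G x y)" for G
  proof -
    have "(\<Union>y\<in>tensor_class A d. tensor_class A (G x y)) = tensor_class A (G c d)"
      if x: "tensor_cong A c x" for x
    proof -
      have "(\<Union>y\<in>tensor_class A d. tensor_class A (G x y)) = tensor_class A (G x d)"
      proof (rule UN[OF d])
        fix y assume "tensor_cong A d y"
        then show "tensor_class A (G x y) = tensor_class A (G x d)"
          using that(1) \<open>\<And>x y. tensor_cong A c x \<Longrightarrow> tensor_cong A d y \<Longrightarrow> tensor_cong A (G c d) (G x y)\<close>[OF x]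
          by (intro eq) (meson d tensor_cong.refl tensor_cong.sym tensor_cong.trans)
      qed
      also have "\<dots> = tensor_class A (G c d)"
        by (intro eq \<open>\<And>x y. tensor_cong A c x \<Longrightarrow> tensor_cong A d y \<Longrightarrow> tensor_cong A (G c d) (G x y)\<close>
              x tensor_cong.refl d)
      finally show ?thesis .
    qed
    note inner = this
    show ?thesis
      by (subst UN[OF c]) (simp_all only: inner inner[OF tensor_cong.refl[OF c]])
  qed
  show "tensor_class A c \<otimes>\<^bsub>tensor_square A\<^esub> tensor_class A d =
      tensor_class A (convolution (pair_mult A) c d)"
    unfolding tensor_square_def monoid.simps
  proof (rule UN2)
    fix x y assume x: "tensor_cong A c x" and y: "tensor_cong A d y"
    show "tensor_cong A (convolution (pair_mult A) c d) (convolution (pair_mult A) x y)"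
      using tensor_cong_convolution(1)[OF assms(1) comm x d]
        tensor_cong_convolution(2)[OF assms(1) comm y conjunct2[OF tensor_cong_fin_funs[OF x]]]
      by (rule tensor_cong.trans)
  qed
  show "tensor_class A c \<oplus>\<^bsub>tensor_square A\<^esub> tensor_class A d = tensor_class A (fplus c d)"
    unfolding tensor_square_def ring.simps by (rule UN2) (rule tensor_cong.plus)
  show "r \<odot>\<^bsub>tensor_square A\<^esub> tensor_class A c = tensor_class A (fscale r c)"
    unfolding tensor_square_def module.simps
    by (rule UN[OF c]) (intro eq tensor_cong.scale)
qed

lemma pure_tensor_mult:
  fixes A :: "('k::{semiring_0, monoid_mult}, 'a) module"
  assumes "k_algebra A" and comm: "\<And>a b :: 'k. a * b = b * a"
    and "a \<in> carrier A" "b \<in> carrier A" "c \<in> carrier A" "d \<in> carrier A"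
  shows "pure_tensor A a b \<otimes>\<^bsub>tensor_square A\<^esub> pure_tensor A c d =
      pure_tensor A (a \<otimes>\<^bsub>A\<^esub> c) (b \<otimes>\<^bsub>A\<^esub> d)"
  unfolding pure_tensor_def
  by (subst tensor_square_ops[OF assms(1) comm])
     (use assms in \<open>auto intro: fin_funs_single simp: convolution_single pair_mult_def\<close>)

lemma tensor_form_class:
  fixes A :: "('k::{semiring_0, monoid_mult}, 'a) module"
  assumes "k_algebra A" and comm: "\<And>a b :: 'k. a * b = b * a"
    and f: "f \<in> linear_forms A" and g: "g \<in> linear_forms A"
    and c: "c \<in> fin_funs (carrier A \<times> carrier A)"
  shows "tensor_form f g (tensor_class A c) = lin_ext (\<lambda>(a, b). f a * g b) c"
proof -
  interpret k_algebra A by fact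
  let ?L = "lin_ext (\<lambda>(a, b). f a * g b)"
  have lc: "a * (r * b) = r * (a * b)" for a b r :: 'k by (metis comm mult.assoc)
  have inv: "?L c = ?L d" if "tensor_cong A c d" for c d
    using that
  proof (induction rule: tensor_cong.induct)
    case (plus c d c' d')
    then show ?case
      using tensor_cong_fin_funs[OF plus(1)] tensor_cong_fin_funs[OF plus(2)]
      by (simp add: lin_ext_fplus fin_funs_def)
  next
    case (scale c d r)
    then show ?case using tensor_cong_fin_funs[OF scale(1)]
      by (simp add: lin_ext_fscale fin_funs_def)
  qed (use f g in \<open>simp_all add: lin_ext_fplus lin_ext_fscale lin_ext_single
         finite_subset[OF supp_single] linear_forms_def distrib_left distrib_right mult.assoc lc\<close>)
  have "?L d = ?L c" if "d \<in> tensor_class A c" for d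
    using inv[of c d] that by (simp add: tensor_class_def)
  moreover have "c \<in> tensor_class A c"
    using tensor_cong.refl[OF c] by (simp add: tensor_class_def)
  ultimately have "?L ` tensor_class A c = {?L c}" by blast
  then show ?thesis by (simp add: tensor_form_def)
qed

lemma tensor_form_pure:
  fixes A :: "('k::{semiring_0, monoid_mult}, 'a) module"
  assumes "k_algebra A" and comm: "\<And>a b :: 'k. a * b = b * a"
    and "f \<in> linear_forms A" "g \<in> linear_forms A" and "a \<in> carrier A" "b \<in> carrier A"
  shows "tensor_form f g (pure_tensor A a b) = f a * g b"
  unfolding pure_tensor_def
  by (subst tensor_form_class) (use assms in \<open>auto simp: lin_ext_single intro: fin_funs_single\<close>)

lemma k_algebra_nc_poly_imp:
  assumes "k_algebra (nc_poly X :: ('k::{semiring_0, monoid_mult}, 'x list \<Rightarrow> 'k) module)"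
  shows "(a::'k) * b = b * a"
proof -
  interpret k_algebra "nc_poly X :: ('k, 'x list \<Rightarrow> 'k) module" by fact
  let ?e = "single [] :: 'x list \<Rightarrow> 'k"
  have e: "?e \<in> fin_funs (lists X)" by (auto intro: fin_funs_single)
  have ae: "fscale a ?e \<in> fin_funs (lists X)" by (rule fin_funs_fscale[OF e])
  have fin: "finite (supp ?e)" "finite (supp (fscale a ?e))"
    using e ae by (auto simp: fin_funs_def)
  have "convolution (@) (fscale a ?e) (fscale b ?e) = fscale b (convolution (@) (fscale a ?e) ?e)"
    using smult_mult_right[of "fscale a ?e" ?e b] e ae by (simp add: nc_poly_def)
  moreover have "convolution (@) (fscale a ?e) (fscale b ?e)
      = fscale a (convolution (@) ?e (fscale b ?e))"
    using smult_mult_left[of ?e "fscale b ?e" a] e fin_funs_fscale[OF e, of b]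
    by (simp add: nc_poly_def)
  moreover have "convolution (@) ?e (fscale b ?e) = fscale b ?e"
    using l_one[of "fscale b ?e"] fin_funs_fscale[OF e, of b] by (simp add: nc_poly_def)
  moreover have "convolution (@) (fscale a ?e) ?e = fscale a ?e"
    using r_one[of "fscale a ?e"] ae by (simp add: nc_poly_def)
  ultimately have "fscale a (fscale b ?e) [] = fscale b (fscale a ?e) []" by simp
  then show ?thesis by (simp add: fscale_def single_def)
qed

lemma convolution_assoc:
  fixes c :: "'s \<Rightarrow> 'k::{semiring_0, monoid_mult}"
  assumes comm: "\<And>a b :: 'k. a * b = b * a"
   and m: "\<And>s t. s \<in> S \<Longrightarrow> t \<in> S \<Longrightarrow> m s t \<in> S"
   and ass: "\<And>s t u. s \<in> S \<Longrightarrow> t \<in> S \<Longrightarrow> u \<in> S \<Longrightarrow> m (m s t) u = m s (m t u)"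
   and c: "c \<in> fin_funs S" and d: "d \<in> fin_funs S" and e: "e \<in> fin_funs S"
 shows "convolution m (convolution m c d) e = convolution m c (convolution m d e)"
proof -
  note [simp] = convolution_fplus_left convolution_fplus_right convolution_fscale_left
    convolution_fscale_right[OF _ _ comm] fin_supp convolution_single convolution_zero
    fin_funs_fplus fin_funs_fscale fin_funs_single m
    fin_supp[OF convolution_closed[of _ S _ m]] fin_supp[OF fin_funs_fscale[of _ S]]
    fin_supp[OF fin_funs_single[of _ S]] fin_supp[OF fin_funs_fplus[of _ S]]
    fin_funs_zero convolution_closed
  have 1: "convolution m (convolution m (single s) (single t)) e = convolution m (single s) (convolution m (single t) e)" if st: "s \<in> S" "t \<in> S" for s t
    using e
    by (induction e rule: fin_funs_induct) (use st ass in \<open>simp_all add: fin_supp[of _ S]\<close>)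
  have 2: "convolution m (convolution m (single s) d) e = convolution m (single s) (convolution m d e)" if st: "s \<in> S" for s
    using d
    by (induction d rule: fin_funs_induct) (use st 1 e in \<open>simp_all add: fin_supp[of _ S]\<close>)
  show ?thesis using c
    by (induction c rule: fin_funs_induct) (use 2 d e in \<open>simp_all add: fin_supp[of _ S]\<close>)
qed

lemma k_algebra_nc_poly:
  assumes comm: "\<And>a b :: 'k::{semiring_0, monoid_mult}. a * b = b * a"
  shows "k_algebra (nc_poly X :: ('k, 'x list \<Rightarrow> 'k) module)"
proof -
  have one: "convolution (@) (single []) c = c \<and> convolution (@) c (single []) = c"
    if "c \<in> fin_funs (lists X)" for c :: "'x list \<Rightarrow> 'k"
    using that
    by (induction c rule: fin_funs_induct)
     (simp_all add: convolution_fplus_left convolution_fplus_right convolution_fscale_left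
    convolution_fscale_right[OF _ _ comm] convolution_single convolution_zero fin_supp
    fin_supp[OF fin_funs_single[of _ UNIV]] fin_supp[OF fin_funs_fscale[OF fin_funs_single[of _ UNIV]]])
  show ?thesis
    by unfold_locales
     (auto simp: nc_poly_def fin_funs_fplus fin_funs_zero fplus_zero convolution_closed fin_funs_single one
         convolution_assoc[OF comm, where S="lists X"] convolution_fplus_left convolution_fplus_right fin_supp convolution_zero
         fin_funs_fscale convolution_fscale_left convolution_fscale_right[OF _ _ comm] comm Units_def
       , auto simp: fplus_def fscale_def algebra_simps)
qed

text \<open>
  In an algebra, \<open>(r \<odot> x) \<otimes> y = r \<odot> (x \<otimes> y) = x \<otimes> (r \<odot> y)\<close>; for polynomials this forces the
  scalars to commute.  The assumption \<open>k_algebra (nc_poly X)\<close> therefore holds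
  exactly for commutative semirings.
\<close>

corollary k_algebra_nc_poly_iff:
  "k_algebra (nc_poly X :: ('k::{semiring_0, monoid_mult}, 'x list \<Rightarrow> 'k) module) \<longleftrightarrow>
    (\<forall>a b :: 'k. a * b = b * a)"
  using k_algebra_nc_poly k_algebra_nc_poly_imp by blast

end

theory Submission
  imports Defs
begin

text \<open>
  If \<open>f\<close> and \<open>g\<close> are coefficients of matrix representations \<open>\<mu>\<close> and \<open>\<nu>\<close>, then \<open>f \<otimes> g\<close> is a
  coefficient of the Kronecker product \<open>\<mu> \<otimes> \<nu>\<close>, which is a representation of the tensor square
  because the scalars commute.  Composing with the algebra morphism \<open>\<Delta>\<close> gives a
  representation of \<open>A\<close> having \<open>(f \<otimes> g) \<circ> \<Delta>\<close> as a coefficient.  The case of words is the same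
  statement for \<open>nc_poly X\<close>, since a monoid representation of the words extends linearly to the
  polynomials.
\<close>

subsection \<open>Kronecker products of matrices\<close>

text \<open>A pair of indices \<open>(i1, i2)\<close> is encoded as
  \<open>i1 * dim_row N + i2\<close> for rows, and likewise for columns, so \<open>div\<close> and
  \<open>mod\<close> recover its components. The entry of \<open>M\<close> is the left
  factor.\<close>

definition kron :: "'k::times mat \<Rightarrow> 'k mat \<Rightarrow> 'k mat" where
  "kron M N = mat (dim_row M * dim_row N) (dim_col M * dim_col N)
     (\<lambda>(i, j). M $$ (i div dim_row N, j div dim_col N) * N $$ (i mod dim_row N, j mod dim_col N))"

lemma div_mod_less_mult:
  fixes i n m :: nat
  assumes "i < n * m"
  shows "i div m < n" "i mod m < m"
proof -
  have "0 < m" using assms by (cases m) auto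
  then show "i div m < n" "i mod m < m"
    using assms by (simp_all add: less_mult_imp_div_less)
qed

text \<open>The range \<open>{..<n * m}\<close> splits into \<open>n\<close> consecutive blocks of
  length \<open>m\<close>. On block \<open>i\<close> the quotient by \<open>m\<close> is constantly
  \<open>i\<close> and the remainder runs through \<open>{..<m}\<close>. This decodes the inner
  index of a product of Kronecker products.\<close>

lemma sum_div_mod:
  fixes h :: "nat \<Rightarrow> nat \<Rightarrow> 'b::comm_monoid_add"
  shows "(\<Sum>k<n * m. h (k div m) (k mod m)) = (\<Sum>i<n. \<Sum>j<m. h i j)"
proof -
  have "(\<Sum>k<n * m. h (k div m) (k mod m)) = (\<Sum>i<n. \<Sum>k\<in>{i * m..<i * m + m}. h (k div m) (k mod m))"
    by (rule sum.nat_group[symmetric])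
  also have "\<dots> = (\<Sum>i<n. \<Sum>j<m. h i j)"
  proof (rule sum.cong[OF HOL.refl])
    fix i
    have "(\<Sum>k\<in>{i * m..<i * m + m}. h (k div m) (k mod m)) =
        (\<Sum>j\<in>{0..<m}. h ((j + i * m) div m) ((j + i * m) mod m))"
      using sum.shift_bounds_nat_ivl[of "\<lambda>k. h (k div m) (k mod m)" 0 "i * m" m]
      by (simp add: add.commute)
    also have "\<dots> = (\<Sum>j<m. h i j)"
      by (rule sum.cong) auto
    finally show "(\<Sum>k\<in>{i * m..<i * m + m}. h (k div m) (k mod m)) = (\<Sum>j<m. h i j)" .
  qed
  finally show ?thesis .
qed

lemma index_mult_mat_sum:
  assumes "M \<in> carrier_mat a b" "N \<in> carrier_mat b c" "i < a" "j < c"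
  shows "(M * N) $$ (i, j) = (\<Sum>k<b. M $$ (i, k) * N $$ (k, j))"
  using assms by (simp add: scalar_prod_def lessThan_atLeast0)

lemma kron_carrier:
  assumes "M \<in> carrier_mat a b" "N \<in> carrier_mat c d"
  shows "kron M N \<in> carrier_mat (a * c) (b * d)"
  using assms by (simp add: kron_def)

lemma index_kron:
  assumes "M \<in> carrier_mat a b" "N \<in> carrier_mat c d" "i < a * c" "j < b * d"
  shows "kron M N $$ (i, j) = M $$ (i div c, j div d) * N $$ (i mod c, j mod d)"
  using assms by (simp add: kron_def)

lemma kron_one:
  "kron (1\<^sub>m n) (1\<^sub>m m) = (1\<^sub>m (n * m) :: 'k::{semiring_0, monoid_mult} mat)"
proof (rule eq_matI)
  fix i j assume "i < dim_row (1\<^sub>m (n * m) :: 'k mat)" "j < dim_col (1\<^sub>m (n * m) :: 'k mat)"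
  then have ij: "i < n * m" "j < n * m" by simp_all
  have "i = j \<longleftrightarrow> i div m = j div m \<and> i mod m = j mod m"
    by (metis div_mult_mod_eq)
  then show "kron (1\<^sub>m n) (1\<^sub>m m) $$ (i, j) = (1\<^sub>m (n * m) :: 'k mat) $$ (i, j)"
    using div_mod_less_mult[OF ij(1)] div_mod_less_mult[OF ij(2)] ij
    by (subst index_kron[OF one_carrier_mat one_carrier_mat]) auto
qed (simp_all add: kron_def)

text \<open>Both sides are the same sum over pairs of inner indices, decoded by
  \<open>sum_div_mod\<close>. The shapes are rectangular because the rule is also applied to the
  rows and columns that surround a representation.\<close>

lemma kron_mult:
  fixes M :: "'k::semiring_0 mat"
  assumes comm: "\<And>a b :: 'k. a * b = b * a"
    and M: "M \<in> carrier_mat a b" and M': "M' \<in> carrier_mat b c"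
    and N: "N \<in> carrier_mat d e" and N': "N' \<in> carrier_mat e f"
  shows "kron (M * M') (N * N') = kron M N * kron M' N'"
proof (rule eq_matI)
  \<comment> \<open>Commutativity of the scalars enters here: an entry of \<open>N\<close> has to
    move past an entry of \<open>M'\<close>.\<close>
  have swap: "(x * y) * (z * w) = (x * z) * (y * w)" for x y z w :: 'k
    by (metis comm mult.assoc)
  fix i j assume "i < dim_row (kron M N * kron M' N')" "j < dim_col (kron M N * kron M' N')"
  then have i: "i < a * d" and j: "j < c * f"
    using M M' N N' by (simp_all add: kron_def)
  note ij = div_mod_less_mult[OF i] div_mod_less_mult[OF j]
  let ?h = "\<lambda>k l. (M $$ (i div d, k) * N $$ (i mod d, l)) * (M' $$ (k, j div f) * N' $$ (l, j mod f))"
  have "kron (M * M') (N * N') $$ (i, j) = (M * M') $$ (i div d, j div f) * (N * N') $$ (i mod d, j mod f)"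
    by (rule index_kron[OF mult_carrier_mat[OF M M'] mult_carrier_mat[OF N N'] i j])
  also have "\<dots> = (\<Sum>k<b. \<Sum>l<e. ?h k l)"
    by (simp only: index_mult_mat_sum[OF M M' ij(1,3)] index_mult_mat_sum[OF N N' ij(2,4)]
        sum_product swap)
  also have "\<dots> = (\<Sum>k<b * e. ?h (k div e) (k mod e))"
    by (rule sum_div_mod[symmetric])
  also have "\<dots> = (\<Sum>k<b * e. kron M N $$ (i, k) * kron M' N' $$ (k, j))"
    by (rule sum.cong) (simp_all add: index_kron[OF M N i] index_kron[OF M' N' _ j])
  also have "\<dots> = (kron M N * kron M' N') $$ (i, j)"
    by (rule index_mult_mat_sum[OF kron_carrier[OF M N] kron_carrier[OF M' N'] i j, symmetric])
  finally show "kron (M * M') (N * N') $$ (i, j) = (kron M N * kron M' N') $$ (i, j)" .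
qed (use assms in \<open>simp_all add: kron_def\<close>)

text \<open>This exhibits a coefficient as a two-sided linear combination of the entries of
  \<open>M\<close>, so that linearity passes from the entries to the coefficient.\<close>

lemma row_mat_col_entry:
  fixes M :: "'k::semiring_0 mat"
  assumes L: "L \<in> carrier_mat 1 n" and M: "M \<in> carrier_mat n n" and G: "G \<in> carrier_mat n 1"
  shows "(L * M * G) $$ (0, 0) = (\<Sum>j<n. \<Sum>i<n. L $$ (0, i) * M $$ (i, j) * G $$ (j, 0))"
  by (subst index_mult_mat_sum[OF mult_carrier_mat[OF L M] G])
     (auto simp: index_mult_mat_sum[OF L M] sum_distrib_right)


subsection \<open>Linear extensions\<close>

lemma lin_ext_cong: "(\<And>s. s \<in> supp c \<Longrightarrow> f s = g s) \<Longrightarrow> lin_ext f c = lin_ext g c"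
  by (simp add: lin_ext_def)

lemma lin_ext_sum:
  assumes "finite I"
  shows "lin_ext (\<lambda>s. \<Sum>i\<in>I. f i s) c = (\<Sum>i\<in>I. lin_ext (f i) c)"
  unfolding lin_ext_def sum_distrib_left by (rule sum.swap)

text \<open>In \<open>lin_ext\<close> the values of \<open>c\<close> multiply from the left, so they
  must commute with \<open>r\<close> before \<open>r\<close> can leave the sum; \<open>q\<close>
  leaves it by associativity alone.\<close>

lemma lin_ext_scale:
  fixes c :: "'s \<Rightarrow> 'k::semiring_0"
  assumes "\<And>a b :: 'k. a * b = b * a"
  shows "lin_ext (\<lambda>s. r * f s * q) c = r * lin_ext f c * q"
proof -
  have "a * (r * b * q) = r * (a * b) * q" for a b :: 'k
    by (metis assms mult.assoc)
  then show ?thesis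
    by (simp add: lin_ext_def sum_distrib_left sum_distrib_right)
qed

text \<open>The map from \<open>M\<close> to \<open>L * M * G\<close> is linear in the entries of
  \<open>M\<close>, hence commutes with linear extension. It is used with words and with pairs of
  algebra elements as index set.\<close>

lemma lin_ext_row_mat_col:
  fixes c :: "'s \<Rightarrow> 'k::semiring_0"
  assumes comm: "\<And>a b :: 'k. a * b = b * a"
    and L: "L \<in> carrier_mat 1 n" and G: "G \<in> carrier_mat n 1"
    and M: "\<And>s. s \<in> supp c \<Longrightarrow> M s \<in> carrier_mat n n"
  shows "lin_ext (\<lambda>s. (L * M s * G) $$ (0, 0)) c =
    (L * mat n n (\<lambda>ij. lin_ext (\<lambda>s. M s $$ ij) c) * G) $$ (0, 0)"
proof -
  have "lin_ext (\<lambda>s. (L * M s * G) $$ (0, 0)) c =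
      lin_ext (\<lambda>s. \<Sum>j<n. \<Sum>i<n. L $$ (0, i) * M s $$ (i, j) * G $$ (j, 0)) c"
    by (rule lin_ext_cong) (rule row_mat_col_entry[OF L M G])
  also have "\<dots> = (\<Sum>j<n. \<Sum>i<n. L $$ (0, i) * lin_ext (\<lambda>s. M s $$ (i, j)) c * G $$ (j, 0))"
    by (simp add: lin_ext_sum lin_ext_scale[OF comm])
  also have "\<dots> = (L * mat n n (\<lambda>ij. lin_ext (\<lambda>s. M s $$ ij) c) * G) $$ (0, 0)"
    by (subst row_mat_col_entry[OF L _ G]) auto
  finally show ?thesis .
qed

lemma lin_ext_convolution:
  fixes c d :: "'s \<Rightarrow> 'k::semiring_0"
  assumes c: "finite (supp c)" and d: "finite (supp d)"
  shows "lin_ext h (convolution m c d) = (\<Sum>s\<in>supp c. \<Sum>t\<in>supp d. c s * d t * h (m s t))"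
proof -
  \<comment> \<open>Terms of the convolution may cancel, so \<open>?P\<close> can exceed its
    support; a finite superset is enough for evaluating \<open>lin_ext\<close>.\<close>
  let ?P = "(\<lambda>(s, t). m s t) ` (supp c \<times> supp d)"
  have P: "finite ?P" using c d by simp
  have sub: "supp (convolution m c d) \<subseteq> ?P"
    using convolution_closed[of c "supp c" d] by (auto simp: supp_def convolution_def
        split: if_splits elim!: sum.not_neutral_contains_not_neutral)
  have "lin_ext h (convolution m c d) =
      (\<Sum>p\<in>?P. \<Sum>s\<in>supp c. \<Sum>t\<in>supp d. if m s t = p then c s * d t * h p else 0)"
    unfolding lin_ext_superset[OF P sub]
    by (auto simp: convolution_def sum_distrib_right intro!: sum.cong)
  \<comment> \<open>With the sum over \<open>p\<close> innermost, each pair \<open>(s, t)\<close>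
    contributes only at \<open>p = m s t\<close>.\<close>
  also have "\<dots> = (\<Sum>s\<in>supp c. \<Sum>t\<in>supp d. \<Sum>p\<in>?P. if m s t = p then c s * d t * h p else 0)"
    by (simp only: sum.swap[of _ _ ?P])
  also have "\<dots> = (\<Sum>s\<in>supp c. \<Sum>t\<in>supp d. c s * d t * h (m s t))"
    by (intro sum.cong HOL.refl) (use P in \<open>auto simp: sum.delta'\<close>)
  finally show ?thesis .
qed

text \<open>Convolution is the bilinear extension of \<open>m\<close>, so a map that is
  multiplicative on indices stays multiplicative after linear extension. It serves both
  \<open>pair_mult\<close> on pairs and concatenation of words.\<close>

lemma mat_lin_ext_convolution:
  fixes c d :: "'s \<Rightarrow> 'k::semiring_0"
  assumes comm: "\<And>a b :: 'k. a * b = b * a"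
    and c: "c \<in> fin_funs S" and d: "d \<in> fin_funs S"
    and M: "\<And>s. s \<in> S \<Longrightarrow> M s \<in> carrier_mat n n"
    and hom: "\<And>s t. s \<in> S \<Longrightarrow> t \<in> S \<Longrightarrow> M (m s t) = M s * M t"
  shows "mat n n (\<lambda>ij. lin_ext (\<lambda>s. M s $$ ij) (convolution m c d)) =
    mat n n (\<lambda>ij. lin_ext (\<lambda>s. M s $$ ij) c) * mat n n (\<lambda>ij. lin_ext (\<lambda>s. M s $$ ij) d)"
    (is "?F (convolution m c d) = ?F c * ?F d")
proof (rule eq_matI)
  have swap: "(x * y) * (z * w) = (x * z) * (y * w)" for x y z w :: 'k
    by (metis comm mult.assoc)
  have S: "supp c \<subseteq> S" "supp d \<subseteq> S" using c d by (auto simp: fin_funs_def)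
  fix i j assume "i < dim_row (?F c * ?F d)" "j < dim_col (?F c * ?F d)"
  then have ij: "i < n" "j < n" by simp_all
  have "lin_ext (\<lambda>s. M s $$ (i, j)) (convolution m c d) =
      (\<Sum>s\<in>supp c. \<Sum>t\<in>supp d. c s * d t * (\<Sum>k<n. M s $$ (i, k) * M t $$ (k, j)))"
    unfolding lin_ext_convolution[OF fin_supp[OF c] fin_supp[OF d]]
    using S by (intro sum.cong HOL.refl) (auto simp: hom index_mult_mat_sum[OF M M ij] subset_iff)
  \<comment> \<open>Commutativity groups each scalar with its own matrix entry, so that the double
    sum factors into two linear extensions for every \<open>k\<close>.\<close>
  also have "\<dots> = (\<Sum>s\<in>supp c. \<Sum>t\<in>supp d. \<Sum>k<n. (c s * M s $$ (i, k)) * (d t * M t $$ (k, j)))"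
    by (simp only: sum_distrib_left swap)
  also have "\<dots> = (\<Sum>k<n. \<Sum>s\<in>supp c. \<Sum>t\<in>supp d. (c s * M s $$ (i, k)) * (d t * M t $$ (k, j)))"
    by (simp only: sum.swap[of _ "{..<n}"])
  also have "\<dots> = (\<Sum>k<n. lin_ext (\<lambda>s. M s $$ (i, k)) c * lin_ext (\<lambda>s. M s $$ (k, j)) d)"
    by (simp only: lin_ext_def sum_product)
  also have "\<dots> = (?F c * ?F d) $$ (i, j)"
    by (subst index_mult_mat_sum[where a = n and b = n and c = n]) (use ij in auto)
  finally show "?F (convolution m c d) $$ (i, j) = (?F c * ?F d) $$ (i, j)" using ij by simp
qed simp_all


subsection \<open>Matrix representations and their coefficients\<close>

text \<open>Linearity is stated entry by entry through \<open>linear_forms\<close>, so that one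
  notion covers fields and semirings and the entries can be fed directly to
  \<open>tensor_form\<close>.\<close>

definition matrix_reps ::
  "('k::{semiring_0, monoid_mult}, 'a) module \<Rightarrow> nat \<Rightarrow> ('a \<Rightarrow> 'k mat) set" where
  "matrix_reps A n = {\<mu>. \<mu> \<in> carrier A \<rightarrow> carrier_mat n n \<and>
     (\<forall>i<n. \<forall>j<n. (\<lambda>x. \<mu> x $$ (i, j)) \<in> linear_forms A) \<and>
     \<mu> \<one>\<^bsub>A\<^esub> = 1\<^sub>m n \<and>
     (\<forall>x\<in>carrier A. \<forall>y\<in>carrier A. \<mu> (x \<otimes>\<^bsub>A\<^esub> y) = \<mu> x * \<mu> y)}"

text \<open>The common form of the two Sweedler duals, for which closure is proved once.\<close>

definition rep_forms :: "('k::{semiring_0, monoid_mult}, 'a) module \<Rightarrow> ('a \<Rightarrow> 'k) set" where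
  "rep_forms A = {f. \<exists>n lam \<mu> gam.
     lam \<in> carrier_mat 1 n \<and> gam \<in> carrier_mat n 1 \<and> \<mu> \<in> matrix_reps A n \<and>
     (\<forall>x\<in>carrier A. f x = (lam * \<mu> x * gam) $$ (0, 0))}"

lemma rep_forms_linear:
  fixes A :: "('k::{semiring_0, monoid_mult}, 'a) module" (structure)
  assumes "k_algebra A" and comm: "\<And>a b :: 'k. a * b = b * a" and f: "f \<in> rep_forms A"
  shows "f \<in> linear_forms A"
proof -
  interpret k_algebra A by fact
  obtain n L \<mu> G where L: "L \<in> carrier_mat 1 n" and G: "G \<in> carrier_mat n 1"
    and \<mu>: "\<mu> \<in> matrix_reps A n" and fx: "\<And>x. x \<in> carrier A \<Longrightarrow> f x = (L * \<mu> x * G) $$ (0, 0)"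
    using f unfolding rep_forms_def by blast
  have \<mu>c: "\<mu> x \<in> carrier_mat n n" if "x \<in> carrier A" for x
    using \<mu> that by (auto simp: matrix_reps_def)
  have fs: "f x = (\<Sum>j<n. \<Sum>i<n. L $$ (0, i) * \<mu> x $$ (i, j) * G $$ (j, 0))" if "x \<in> carrier A" for x
    by (simp only: fx[OF that] row_mat_col_entry[OF L \<mu>c[OF that] G])
  have lin: "\<mu> (x \<oplus> y) $$ (i, j) = \<mu> x $$ (i, j) + \<mu> y $$ (i, j)"
      "\<mu> (r \<odot> x) $$ (i, j) = r * \<mu> x $$ (i, j)"
    if "x \<in> carrier A" "y \<in> carrier A" "i < n" "j < n" for x y r i j
    using \<mu> that by (auto simp: matrix_reps_def linear_forms_def)
  have lc: "a * (r * b) * c = r * (a * b * c)" for a b c r :: 'k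
    by (metis comm mult.assoc)
  show ?thesis
    by (auto simp: linear_forms_def fs lin smult_closed distrib_left distrib_right sum.distrib
        sum_distrib_left lc intro!: sum.cong)
qed

section \<open>Closure of representative forms under the dual law\<close>

context
  fixes A :: "('k::{semiring_0, monoid_mult}, 'a) module" (structure)
  assumes alg: "k_algebra A" and comm: "\<And>a b :: 'k. a * b = b * a"
begin

interpretation k_algebra A by (rule alg)

lemma rep_forms_dual_law:
  assumes \<Delta>: "\<Delta> \<in> algebra_homs A (tensor_square A)"
    and f: "f \<in> rep_forms A" and g: "g \<in> rep_forms A"
  shows "dual_law \<Delta> f g \<in> rep_forms A"
proof -
  let ?T = "tensor_square A" and ?S = "carrier A \<times> carrier A"
  obtain n L \<mu> G where L: "L \<in> carrier_mat 1 n" and G: "G \<in> carrier_mat n 1"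
    and \<mu>: "\<mu> \<in> matrix_reps A n" and fx: "\<And>x. x \<in> carrier A \<Longrightarrow> f x = (L * \<mu> x * G) $$ (0, 0)"
    using f unfolding rep_forms_def by blast
  obtain m L' \<nu> G' where L': "L' \<in> carrier_mat 1 m" and G': "G' \<in> carrier_mat m 1"
    and \<nu>: "\<nu> \<in> matrix_reps A m" and gx: "\<And>x. x \<in> carrier A \<Longrightarrow> g x = (L' * \<nu> x * G') $$ (0, 0)"
    using g unfolding rep_forms_def by blast
  have \<mu>c: "\<mu> x \<in> carrier_mat n n" and \<nu>c: "\<nu> x \<in> carrier_mat m m" if "x \<in> carrier A" for x
    using \<mu> \<nu> that by (auto simp: matrix_reps_def)
  have \<mu>1: "\<mu> \<one> = 1\<^sub>m n" and \<nu>1: "\<nu> \<one> = 1\<^sub>m m"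
    using \<mu> \<nu> by (auto simp: matrix_reps_def)
  have \<mu>m: "\<mu> (x \<otimes> y) = \<mu> x * \<mu> y" and \<nu>m: "\<nu> (x \<otimes> y) = \<nu> x * \<nu> y"
    if "x \<in> carrier A" "y \<in> carrier A" for x y
    using \<mu> \<nu> that by (auto simp: matrix_reps_def)
  define K where "K = (\<lambda>s. kron (\<mu> (fst s)) (\<nu> (snd s)))"
  have K: "K s \<in> carrier_mat (n * m) (n * m)" if "s \<in> ?S" for s
    unfolding K_def using that by (intro kron_carrier \<mu>c \<nu>c) auto
  have Km: "K (pair_mult A s t) = K s * K t" if "s \<in> ?S" "t \<in> ?S" for s t
  proof -
    from that have "fst s \<in> carrier A" "snd s \<in> carrier A" "fst t \<in> carrier A" "snd t \<in> carrier A"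
      by auto
    then show ?thesis
      unfolding K_def pair_mult_def by (simp add: \<mu>m \<nu>m kron_mult[OF comm \<mu>c \<mu>c \<nu>c \<nu>c])
  qed
  define F where "F = (\<lambda>c. mat (n * m) (n * m) (\<lambda>pq. lin_ext (\<lambda>s. K s $$ pq) c))"
  \<comment> \<open>\<open>F\<close> acts on representatives, \<open>R\<close> on classes. Each
    entry of the Kronecker product is an entry of \<open>\<mu>\<close> times an entry of
    \<open>\<nu>\<close>, both linear forms, so \<open>tensor_form\<close> makes it well defined on
    classes.\<close>
  define R where "R = (\<lambda>T. mat (n * m) (n * m) (\<lambda>(p, q).
    tensor_form (\<lambda>a. \<mu> a $$ (p div m, q div m)) (\<lambda>b. \<nu> b $$ (p mod m, q mod m)) T))"
  have R: "R (tensor_class A c) = F c" if c: "c \<in> fin_funs ?S" for c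
  proof (rule eq_matI)
    fix p q assume "p < dim_row (F c)" "q < dim_col (F c)"
    then have pq: "p < n * m" "q < n * m" by (simp_all add: F_def)
    note less = div_mod_less_mult[OF pq(1)] div_mod_less_mult[OF pq(2)]
    have "R (tensor_class A c) $$ (p, q) =
        lin_ext (\<lambda>(a, b). \<mu> a $$ (p div m, q div m) * \<nu> b $$ (p mod m, q mod m)) c"
      using pq \<mu> \<nu> less c
      by (simp add: R_def matrix_reps_def tensor_form_class[OF alg comm])
    also have "\<dots> = lin_ext (\<lambda>s. K s $$ (p, q)) c"
      using c pq by (intro lin_ext_cong)
        (auto simp: K_def fin_funs_def subset_iff index_kron[OF \<mu>c \<nu>c])
    finally show "R (tensor_class A c) $$ (p, q) = F c $$ (p, q)"
      using pq by (simp add: F_def)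
  qed (simp_all add: R_def F_def)
  have "\<exists>c. c \<in> fin_funs ?S \<and> \<Delta> x = tensor_class A c" if "x \<in> carrier A" for x
  proof -
    have "\<Delta> x \<in> carrier ?T" using \<Delta> that unfolding algebra_homs_def linear_maps_def by blast
    then show ?thesis by (auto simp: tensor_square_def)
  qed
  \<comment> \<open>\<open>\<gamma>\<close> merely chooses representatives and need not be additive
    or multiplicative. The laws of \<open>\<Delta>\<close> are equalities of classes and reach
    \<open>F\<close> only through \<open>R\<close>.\<close>
  then obtain \<gamma> where \<gamma>: "\<And>x. x \<in> carrier A \<Longrightarrow> \<gamma> x \<in> fin_funs ?S"
    and \<Delta>_eq: "\<And>x. x \<in> carrier A \<Longrightarrow> \<Delta> x = tensor_class A (\<gamma> x)"
    by metis
  have F_fplus: "F (fplus c d) $$ (p, q) = F c $$ (p, q) + F d $$ (p, q)"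
    and F_fscale: "F (fscale r c) $$ (p, q) = r * F c $$ (p, q)"
    if "c \<in> fin_funs ?S" "d \<in> fin_funs ?S" "p < n * m" "q < n * m" for c d p q r
    using that by (simp_all add: F_def lin_ext_fplus lin_ext_fscale fin_supp)
  have lm: "\<Delta> \<in> linear_maps A ?T" and rh: "\<Delta> \<in> ring_hom A ?T"
    using \<Delta> by (simp_all add: algebra_homs_def)
  have \<Delta>_add: "\<Delta> (x \<oplus> y) = tensor_class A (fplus (\<gamma> x) (\<gamma> y))"
    if "x \<in> carrier A" "y \<in> carrier A" for x y
  proof -
    have "\<Delta> (x \<oplus> y) = \<Delta> x \<oplus>\<^bsub>?T\<^esub> \<Delta> y" using lm that by (simp add: linear_maps_def)
    also have "\<dots> = tensor_class A (fplus (\<gamma> x) (\<gamma> y))"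
      unfolding \<Delta>_eq[OF that(1)] \<Delta>_eq[OF that(2)]
      by (rule tensor_square_ops(2)[OF alg comm \<gamma>[OF that(1)] \<gamma>[OF that(2)]])
    finally show ?thesis .
  qed
  have \<Delta>_smult: "\<Delta> (r \<odot> x) = tensor_class A (fscale r (\<gamma> x))" if "x \<in> carrier A" for r x
  proof -
    have "\<Delta> (r \<odot> x) = r \<odot>\<^bsub>?T\<^esub> \<Delta> x" using lm that by (simp add: linear_maps_def)
    also have "\<dots> = tensor_class A (fscale r (\<gamma> x))"
      unfolding \<Delta>_eq[OF that]
      by (rule tensor_square_ops(3)[OF alg comm \<gamma>[OF that] \<gamma>[OF that]])
    finally show ?thesis .
  qed
  have \<Delta>_mult: "\<Delta> (x \<otimes> y) = tensor_class A (convolution (pair_mult A) (\<gamma> x) (\<gamma> y))"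
    if "x \<in> carrier A" "y \<in> carrier A" for x y
  proof -
    have "\<Delta> (x \<otimes> y) = \<Delta> x \<otimes>\<^bsub>?T\<^esub> \<Delta> y" by (rule ring_hom_mult[OF rh that])
    also have "\<dots> = tensor_class A (convolution (pair_mult A) (\<gamma> x) (\<gamma> y))"
      unfolding \<Delta>_eq[OF that(1)] \<Delta>_eq[OF that(2)]
      by (rule tensor_square_ops(1)[OF alg comm \<gamma>[OF that(1)] \<gamma>[OF that(2)]])
    finally show ?thesis .
  qed
  have R_\<Delta>: "R (\<Delta> x) = F (\<gamma> x)" if "x \<in> carrier A" for x
    unfolding \<Delta>_eq[OF that] by (rule R[OF \<gamma>[OF that]])
  have lin: "(\<lambda>x. R (\<Delta> x) $$ (p, q)) \<in> linear_forms A" if "p < n * m" "q < n * m" for p q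
    using that by (simp add: linear_forms_def \<Delta>_add \<Delta>_smult R_\<Delta> R \<gamma> fin_funs_fplus fin_funs_fscale
        F_fplus F_fscale[OF _ fin_funs_zero])
  have R_one: "R (\<Delta> \<one>) = 1\<^sub>m (n * m)"
  proof -
    have "\<Delta> \<one> = tensor_class A (single (\<one>, \<one>))"
      using ring_hom_one[OF rh] by (simp add: tensor_square_def)
    then have "R (\<Delta> \<one>) = F (single (\<one>, \<one>))" by (simp add: R fin_funs_single)
    also have "\<dots> = K (\<one>, \<one>)"
      using K[of "(\<one>, \<one>)"] by (intro eq_matI) (auto simp: F_def lin_ext_single)
    also have "\<dots> = 1\<^sub>m (n * m)" by (simp add: K_def \<mu>1 \<nu>1 kron_one)
    finally show ?thesis .
  qed
  have R_mult: "R (\<Delta> (x \<otimes> y)) = R (\<Delta> x) * R (\<Delta> y)" if xy: "x \<in> carrier A" "y \<in> carrier A" for x y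
  proof -
    have conv: "convolution (pair_mult A) (\<gamma> x) (\<gamma> y) \<in> fin_funs ?S"
      by (rule convolution_closed[OF \<gamma>[OF xy(1)] \<gamma>[OF xy(2)]]) (auto simp: pair_mult_def)
    have "F (convolution (pair_mult A) (\<gamma> x) (\<gamma> y)) = F (\<gamma> x) * F (\<gamma> y)"
      unfolding F_def by (rule mat_lin_ext_convolution[OF comm \<gamma>[OF xy(1)] \<gamma>[OF xy(2)] K Km])
    then show ?thesis
      using conv by (simp add: \<Delta>_mult R_\<Delta> R xy)
  qed
  have "R T \<in> carrier_mat (n * m) (n * m)" for T by (simp add: R_def)
  then have "(\<lambda>x. R (\<Delta> x)) \<in> matrix_reps A (n * m)"
    unfolding matrix_reps_def using lin R_one R_mult by blast
  moreover have "dual_law \<Delta> f g x = (kron L L' * R (\<Delta> x) * kron G G') $$ (0, 0)"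
    if x: "x \<in> carrier A" for x
  proof -
    let ?c = "\<gamma> x"
    have "dual_law \<Delta> f g x = lin_ext (\<lambda>(a, b). f a * g b) ?c"
      unfolding dual_law_def \<Delta>_eq[OF x]
      by (rule tensor_form_class[OF alg comm rep_forms_linear[OF alg comm f]
            rep_forms_linear[OF alg comm g] \<gamma>[OF x]])
    also have "\<dots> = lin_ext (\<lambda>s. (kron L L' * K s * kron G G') $$ (0, 0)) ?c"
    proof (rule lin_ext_cong)
      fix s assume "s \<in> supp ?c"
      then obtain a b where s: "s = (a, b)" and ab: "a \<in> carrier A" "b \<in> carrier A"
        using \<gamma>[OF x] by (auto simp: fin_funs_def)
      \<comment> \<open>Two uses of the mixed product rule; the result is a Kronecker product of
        matrices of size one, whose only entry is \<open>f a * g b\<close>.\<close>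
      have "kron L L' * K s * kron G G' = kron (L * \<mu> a * G) (L' * \<nu> b * G')"
        by (simp add: s K_def kron_mult[OF comm L \<mu>c[OF ab(1)] L' \<nu>c[OF ab(2)]]
            kron_mult[OF comm mult_carrier_mat[OF L \<mu>c[OF ab(1)]] G
              mult_carrier_mat[OF L' \<nu>c[OF ab(2)]] G'])
      moreover have "kron (L * \<mu> a * G) (L' * \<nu> b * G') $$ (0, 0) = f a * g b"
        using L G L' G' by (simp add: kron_def fx gx ab)
      ultimately show "(case s of (a, b) \<Rightarrow> f a * g b) = (kron L L' * K s * kron G G') $$ (0, 0)"
        by (simp add: s)
    qed
    also have "\<dots> = (kron L L' * F ?c * kron G G') $$ (0, 0)"
      unfolding F_def
      using kron_carrier[OF L L'] kron_carrier[OF G G'] \<gamma>[OF x]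
      by (intro lin_ext_row_mat_col[OF comm]) (auto intro: K simp: fin_funs_def)
    finally show ?thesis by (simp add: R_\<Delta>[OF x])
  qed
  moreover have "kron L L' \<in> carrier_mat 1 (n * m)" "kron G G' \<in> carrier_mat (n * m) 1"
    using kron_carrier[OF L L'] kron_carrier[OF G G'] by simp_all
  ultimately show ?thesis unfolding rep_forms_def by blast
qed

end

section \<open>Sweedler's dual over a field as representative forms\<close>

text \<open>Sums and scalar multiples of matrices are computed entrywise, so linearity into the
  matrix algebra amounts to linearity of every entry.\<close>

lemma algebra_homs_module_mat:
  fixes A :: "('k::field, 'a) module"
  assumes "k_algebra A"
  shows "algebra_homs A (module_mat TYPE('k) n n) = matrix_reps A n" (is "?H = ?R")
proof (intro equalityI subsetI)
  fix \<mu> assume \<mu>: "\<mu> \<in> ?H"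
  then have c: "\<mu> x \<in> carrier_mat n n" if "x \<in> carrier A" for x
    using that by (auto simp: algebra_homs_def linear_maps_def module_mat_simps)
  then have "dim_row (\<mu> x) = n" "dim_col (\<mu> x) = n" if "x \<in> carrier A" for x
    using that by blast+
  then show "\<mu> \<in> ?R"
    using \<mu> c by (auto simp: algebra_homs_def linear_maps_def module_mat_simps ring_hom_def
        matrix_reps_def linear_forms_def)
next
  interpret k_algebra A by fact
  fix \<mu> assume \<mu>: "\<mu> \<in> ?R"
  then have c: "\<mu> x \<in> carrier_mat n n" if "x \<in> carrier A" for x
    using that by (auto simp: matrix_reps_def)
  have "\<mu> (x \<oplus>\<^bsub>A\<^esub> y) = \<mu> x + \<mu> y" if "x \<in> carrier A" "y \<in> carrier A" for x y
    using \<mu> c[OF that(1)] c[OF that(2)] c[OF a_closed[OF that]] that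
    by (intro eq_matI) (auto simp: matrix_reps_def linear_forms_def)
  moreover have "\<mu> (r \<odot>\<^bsub>A\<^esub> x) = r \<cdot>\<^sub>m \<mu> x" if "x \<in> carrier A" for r x
    using \<mu> c[OF that] c[OF smult_closed[OF that]] that
    by (intro eq_matI) (auto simp: matrix_reps_def linear_forms_def)
  ultimately show "\<mu> \<in> ?H"
    using \<mu> by (auto simp: algebra_homs_def linear_maps_def module_mat_simps ring_hom_def
        matrix_reps_def)
qed

lemma sweedler_dual_eq_rep_forms:
  assumes "k_algebra A"
  shows "sweedler_dual A = rep_forms A"
proof -
  have "sweedler_dual A = linear_forms A \<inter> rep_forms A"
    unfolding sweedler_dual_def rep_forms_def algebra_homs_module_mat[OF assms] by blast
  \<comment> \<open>A field is commutative, so coefficients of representations are linear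
    forms.\<close>
  then show ?thesis using rep_forms_linear[OF assms mult.commute] by blast
qed

section \<open>Passage between functions on words and forms on polynomials\<close>

lemma rep_forms_nc_poly_if_sweedler_dual_words:
  fixes f :: "'x list \<Rightarrow> 'k::{semiring_0, monoid_mult}"
  assumes comm: "\<And>a b :: 'k. a * b = b * a" and f: "f \<in> sweedler_dual_words X"
  shows "lin_ext f \<in> rep_forms (nc_poly X)"
proof -
  obtain n L \<mu> G where L: "L \<in> carrier_mat 1 n" and G: "G \<in> carrier_mat n 1"
    and \<mu>: "\<And>w. w \<in> lists X \<Longrightarrow> \<mu> w \<in> carrier_mat n n" and \<mu>1: "\<mu> [] = 1\<^sub>m n"
    and \<mu>m: "\<And>u v. u \<in> lists X \<Longrightarrow> v \<in> lists X \<Longrightarrow> \<mu> (u @ v) = \<mu> u * \<mu> v"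
    and fw: "\<And>w. w \<in> lists X \<Longrightarrow> f w = (L * \<mu> w * G) $$ (0, 0)"
    using f unfolding sweedler_dual_words_def Pi_iff by blast
  define F where "F = (\<lambda>c. mat n n (\<lambda>ij. lin_ext (\<lambda>w. \<mu> w $$ ij) c))"
  have "F \<in> matrix_reps (nc_poly X) n"
    unfolding matrix_reps_def mem_Collect_eq
  proof (intro conjI ballI allI impI)
    show "F \<in> carrier (nc_poly X) \<rightarrow> carrier_mat n n" by (simp add: F_def)
    show "(\<lambda>c. F c $$ (i, j)) \<in> linear_forms (nc_poly X)" if "i < n" "j < n" for i j
      using that
      by (auto simp: linear_forms_def nc_poly_def F_def lin_ext_fplus lin_ext_fscale fin_supp)
    show "F \<one>\<^bsub>nc_poly X\<^esub> = 1\<^sub>m n"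
      by (intro eq_matI) (auto simp: F_def nc_poly_def lin_ext_single \<mu>1)
  next
    fix c d :: "'x list \<Rightarrow> 'k"
    assume "c \<in> carrier (nc_poly X)" "d \<in> carrier (nc_poly X)"
    then show "F (c \<otimes>\<^bsub>nc_poly X\<^esub> d) = F c * F d"
      unfolding F_def
      by (simp add: nc_poly_def mat_lin_ext_convolution[OF comm _ _ \<mu> \<mu>m])
  qed
  moreover have "lin_ext f c = (L * F c * G) $$ (0, 0)" if "c \<in> carrier (nc_poly X)" for c
  proof -
    \<comment> \<open>\<open>lin_ext f c\<close> evaluates \<open>f\<close> only on the support of
      \<open>c\<close>, hence only on words over \<open>X\<close>, where the matrix formula for
      \<open>f\<close> is available.\<close>
    have c: "supp c \<subseteq> lists X" using that by (simp add: nc_poly_def fin_funs_def)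
    then have "lin_ext f c = lin_ext (\<lambda>w. (L * \<mu> w * G) $$ (0, 0)) c"
      by (intro lin_ext_cong fw) blast
    also have "\<dots> = (L * F c * G) $$ (0, 0)"
      unfolding F_def using c by (intro lin_ext_row_mat_col[OF comm L G] \<mu>) blast
    finally show ?thesis .
  qed
  ultimately show ?thesis unfolding rep_forms_def using L G by blast
qed

text \<open>The embedding of words as monomials \<open>single w\<close> turns concatenation into
  convolution and the empty word into the unit, so composing a representation with it gives a monoid
  morphism.\<close>

lemma sweedler_dual_words_if_rep_forms_nc_poly:
  fixes h :: "('x list \<Rightarrow> 'k::{semiring_0, monoid_mult}) \<Rightarrow> 'k"
  assumes h: "h \<in> rep_forms (nc_poly X)"
  shows "(\<lambda>w. h (single w)) \<in> sweedler_dual_words X"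
proof -
  obtain n L \<mu> G where L: "L \<in> carrier_mat 1 n" and G: "G \<in> carrier_mat n 1"
    and \<mu>: "\<mu> \<in> matrix_reps (nc_poly X) n"
    and hc: "\<And>c. c \<in> carrier (nc_poly X) \<Longrightarrow> h c = (L * \<mu> c * G) $$ (0, 0)"
    using h unfolding rep_forms_def by blast
  have s: "(single w :: 'x list \<Rightarrow> 'k) \<in> carrier (nc_poly X)" if "w \<in> lists X" for w
    using fin_funs_single[OF that] by (simp add: nc_poly_def)
  have mult: "\<mu> (single (u @ v)) = \<mu> (single u) * \<mu> (single v)" if "u \<in> lists X" "v \<in> lists X" for u v
  proof -
    have "(single (u @ v) :: 'x list \<Rightarrow> 'k) = single u \<otimes>\<^bsub>nc_poly X\<^esub> single v"
      by (simp add: nc_poly_def convolution_single)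
    then show ?thesis using \<mu> s[OF that(1)] s[OF that(2)] by (simp add: matrix_reps_def)
  qed
  have one: "\<mu> (single []) = 1\<^sub>m n" using \<mu> by (simp add: matrix_reps_def nc_poly_def)
  have closed: "(\<lambda>w. \<mu> (single w)) \<in> lists X \<rightarrow> carrier_mat n n"
    using \<mu> s by (auto simp: matrix_reps_def)
  show ?thesis
    unfolding sweedler_dual_words_def mem_Collect_eq
    by (intro exI[of _ n] exI[of _ L] exI[of _ "\<lambda>w. \<mu> (single w)"] exI[of _ G]
        conjI ballI L G closed one mult hc s)
qed

section \<open>Closure of Sweedler's dual, over a field and on words\<close>

theorem theorem6p1:
  fixes A :: "('k::field, 'a) module"
    and \<Delta> :: "'a \<Rightarrow> ('a \<times> 'a \<Rightarrow> 'k) set"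
    and X :: "'x set"
    and \<Delta>' :: "('x list \<Rightarrow> 's::{semiring_0, monoid_mult})
      \<Rightarrow> (('x list \<Rightarrow> 's) \<times> ('x list \<Rightarrow> 's) \<Rightarrow> 's) set"
  shows
    "(k_algebra A \<and> \<Delta> \<in> comultiplications A \<and> \<Delta> \<in> algebra_homs A (tensor_square A) \<longrightarrow>
        (\<forall>f\<in>sweedler_dual A. \<forall>g\<in>sweedler_dual A. dual_law \<Delta> f g \<in> sweedler_dual A)) \<and>
     (k_algebra (nc_poly X :: ('s, 'x list \<Rightarrow> 's) module) \<and>
      \<Delta>' \<in> comultiplications (nc_poly X) \<and>
      \<Delta>' \<in> algebra_homs (nc_poly X) (tensor_square (nc_poly X)) \<longrightarrow>
        (\<forall>f\<in>sweedler_dual_words X. \<forall>g\<in>sweedler_dual_words X.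
           dual_law_words \<Delta>' f g \<in> sweedler_dual_words X))"
proof (intro conjI impI ballI; elim conjE)
  fix f g
  assume "k_algebra A" "\<Delta> \<in> algebra_homs A (tensor_square A)"
    "f \<in> sweedler_dual A" "g \<in> sweedler_dual A"
  then show "dual_law \<Delta> f g \<in> sweedler_dual A"
    by (simp add: sweedler_dual_eq_rep_forms rep_forms_dual_law mult.commute)
next
  fix f g :: "'x list \<Rightarrow> 's"
  assume alg: "k_algebra (nc_poly X :: ('s, 'x list \<Rightarrow> 's) module)"
    and \<Delta>': "\<Delta>' \<in> algebra_homs (nc_poly X) (tensor_square (nc_poly X))"
    and f: "f \<in> sweedler_dual_words X" and g: "g \<in> sweedler_dual_words X"
  \<comment> \<open>The algebra axioms let scalars leave either factor of a product; for multiples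
    of the empty word this forces them to commute.\<close>
  have comm: "a * b = b * a" for a b :: 's by (rule k_algebra_nc_poly_imp[OF alg])
  \<comment> \<open>Extend \<open>f\<close> and \<open>g\<close> to polynomials, apply closure
    there, then restrict the result to words.\<close>
  have "dual_law \<Delta>' (lin_ext f) (lin_ext g) \<in> rep_forms (nc_poly X)"
    by (intro rep_forms_dual_law[OF alg comm \<Delta>'] rep_forms_nc_poly_if_sweedler_dual_words[OF comm] f g)
  then show "dual_law_words \<Delta>' f g \<in> sweedler_dual_words X"
    unfolding dual_law_words_def by (rule sweedler_dual_words_if_rep_forms_nc_poly)
qed

end
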